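(* Let $A\subseteq 2^\omega$ be a $\Pi^0_2$ set and $\delta>0$ with $\mu(A)>\delta$. Then there is a sequence $(f_i)_{i\in\omega}$ of functions, each the characteristic function of a finite union of basic cylinders $[\sigma]$, such that $\int f_i\,d\mu>\delta$ for every $i$, but $(f_i(x))_i$ converges to $0$ for every $x\notin A$.
   Context: $2^\omega$ is Cantor space with the uniform measure $\mu$, $\mu([\sigma])=2^{-\mathrm{length}(\sigma)}$, where $[\sigma]$ is the set of sequences extending the finite binary string $\sigma$. A $\Pi^0_2$ set is one of the form $\bigcap_i\bigcup_j B_{i,j}$ with $(B_{i,j})$ a computable double sequence of basic open sets (each $[\sigma]$ or $\emptyset$). *)

theory Defs
  imports "HOL-Probability.Probability"
begin

text \<open>Partial recursive functions of variable arity. In \<open>PrimRec f g\<close> the recursion argument comes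
  first, and \<open>g\<close> receives the predecessor, the previous value and the parameters, in this order.
  \<open>Mu f\<close> searches for the least zero of \<open>f\<close> in its first argument, all earlier values being
  required to be defined.\<close>

datatype recf = Zero | Succ | Proj nat | Comp recf "recf list" | PrimRec recf recf | Mu recf

inductive evaluates :: "recf \<Rightarrow> nat list \<Rightarrow> nat \<Rightarrow> bool" where
  Zero: "evaluates Zero xs 0"
| Succ: "evaluates Succ [x] (Suc x)"
| Proj: "k < length xs \<Longrightarrow> evaluates (Proj k) xs (xs ! k)"
| Comp: "list_all2 (\<lambda>g y. evaluates g xs y) gs ys \<Longrightarrow> evaluates f ys z \<Longrightarrow> evaluates (Comp f gs) xs z"
| PrimRec_0: "evaluates f xs y \<Longrightarrow> evaluates (PrimRec f g) (0 # xs) y"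
| PrimRec_Suc: "evaluates (PrimRec f g) (n # xs) r \<Longrightarrow> evaluates g (n # r # xs) y
    \<Longrightarrow> evaluates (PrimRec f g) (Suc n # xs) y"
| Mu: "evaluates f (n # xs) 0 \<Longrightarrow> (\<forall>m<n. \<exists>y>0. evaluates f (m # xs) y) \<Longrightarrow> evaluates (Mu f) xs n"

lemma evaluates_deterministic: "evaluates p xs y \<Longrightarrow> evaluates p xs z \<Longrightarrow> y = z"
proof (induction arbitrary: z rule: evaluates.induct)
  case (Comp xs gs ys f z z')
  from Comp.prems obtain ys' where ys': "list_all2 (\<lambda>g y. evaluates g xs y) gs ys'" "evaluates f ys' z'"
    by (cases rule: evaluates.cases) auto
  have "ys = ys'"
    using Comp.IH(1) ys'(1) by (auto simp: list_all2_conv_all_nth intro!: nth_equalityI)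
  then show ?case using Comp.IH(2) ys'(2) by blast
next
  case (PrimRec_0 f xs y g)
  from PrimRec_0.prems show ?case
    by (cases rule: evaluates.cases) (auto intro: PrimRec_0.IH)
next
  case (PrimRec_Suc f g n xs r y)
  from PrimRec_Suc.prems obtain r' where "evaluates (PrimRec f g) (n # xs) r'" "evaluates g (n # r' # xs) z"
    by (cases rule: evaluates.cases) auto
  then show ?case using PrimRec_Suc.IH by blast
next
  case (Mu f n xs)
  from Mu.prems have z: "evaluates f (z # xs) 0" "\<forall>m<z. \<exists>y>0. evaluates f (m # xs) y"
    by (cases rule: evaluates.cases; auto)+
  have "\<not> n < z" using z(2) Mu.IH(1) by fastforce
  moreover have "\<not> z < n" using Mu.IH(2) z(1) by (metis less_numeral_extra(3))
  ultimately show ?case by simp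
qed (erule evaluates.cases; simp)+

definition recursive2 :: "(nat \<Rightarrow> nat \<Rightarrow> nat) \<Rightarrow> bool" where
  "recursive2 h \<longleftrightarrow> (\<exists>p. \<forall>i j. evaluates p [i, j] (h i j))"

text \<open>Cantor space is the type \<open>nat \<Rightarrow> bool\<close>.\<close>

definition cyl :: "bool list \<Rightarrow> (nat \<Rightarrow> bool) set" where
  "cyl \<sigma> = {x. \<forall>k<length \<sigma>. x k = \<sigma> ! k}"

definition cantor_measure :: "(nat \<Rightarrow> bool) measure" where
  "cantor_measure = (\<Pi>\<^sub>M k\<in>UNIV. uniform_count_measure UNIV)"

lemma prob_space_uniform_bool: "prob_space (uniform_count_measure (UNIV :: bool set))"
  by (rule prob_space_uniform_count_measure) auto

lemma cyl_eq_prod_emb: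
  "cyl \<sigma> = prod_emb UNIV (\<lambda>_. uniform_count_measure UNIV) {..<length \<sigma>} (\<Pi>\<^sub>E k\<in>{..<length \<sigma>}. {\<sigma> ! k})"
proof (rule set_eqI)
  fix x
  show "x \<in> cyl \<sigma> \<longleftrightarrow>
    x \<in> prod_emb UNIV (\<lambda>_. uniform_count_measure UNIV) {..<length \<sigma>} (\<Pi>\<^sub>E k\<in>{..<length \<sigma>}. {\<sigma> ! k})"
    by (simp add: cyl_def prod_emb_def space_uniform_count_measure PiE_iff Ball_def)
qed

lemma measure_cyl: "measure cantor_measure (cyl \<sigma>) = (1 / 2) ^ length \<sigma>"
proof -
  have half: "emeasure (uniform_count_measure UNIV) {b} = ennreal (1 / 2)" for b :: bool
    by (subst emeasure_uniform_count_measure) simp_all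
  have "emeasure cantor_measure (cyl \<sigma>)
      = (\<Prod>k<length \<sigma>. emeasure (uniform_count_measure UNIV) {\<sigma> ! k})"
    unfolding cantor_measure_def cyl_eq_prod_emb
    by (rule emeasure_PiM_emb)
       (simp_all add: sets_uniform_count_measure prob_space_uniform_bool)
  also have "\<dots> = ennreal ((1 / 2) ^ length \<sigma>)"
    unfolding half prod_constant card_lessThan by (rule ennreal_power) simp
  finally show ?thesis
    by (simp add: measure_def)
qed

text \<open>An effective coding of the basic open sets: \<open>0\<close> codes the empty set, and a positive number
  codes the cylinder of the string read off its binary expansion (least significant digit
  first) with the leading \<open>1\<close> dropped.\<close>

fun string_code :: "bool list \<Rightarrow> nat" where
  "string_code [] = 1"
| "string_code (b # \<sigma>) = 2 * string_code \<sigma> + of_bool b"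

fun basic_code :: "bool list option \<Rightarrow> nat" where
  "basic_code None = 0"
| "basic_code (Some \<sigma>) = string_code \<sigma>"

fun basic_open :: "bool list option \<Rightarrow> (nat \<Rightarrow> bool) set" where
  "basic_open None = {}"
| "basic_open (Some \<sigma>) = cyl \<sigma>"

lemma string_code_nonzero [simp]: "string_code \<sigma> \<noteq> 0" "0 \<noteq> string_code \<sigma>"
  by (induction \<sigma>) auto

lemma string_code_surj: "n > 0 \<Longrightarrow> \<exists>\<sigma>. string_code \<sigma> = n"
proof (induction n rule: less_induct)
  case (less n)
  show ?case
  proof (cases "n = 1")
    case True
    then show ?thesis by (intro exI[of _ "[]"]) simp
  next
    case False
    with less.prems have "n div 2 < n" "n div 2 > 0" by auto
    with less.IH obtain \<sigma> where "string_code \<sigma> = n div 2" by blast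
    then have "string_code (odd n # \<sigma>) = n" by (auto simp: of_bool_def)
    then show ?thesis by blast
  qed
qed

lemma string_code_inj: "string_code \<sigma> = string_code \<tau> \<Longrightarrow> \<sigma> = \<tau>"
proof (induction \<sigma> arbitrary: \<tau>)
  case Nil
  then show ?case by (cases \<tau>) (auto simp: of_bool_def split: if_splits)
next
  case (Cons b \<sigma>)
  show ?case
  proof (cases \<tau>)
    case Nil
    then show ?thesis using Cons.prems by (auto simp: of_bool_def split: if_splits)
  next
    case (Cons c \<rho>)
    with Cons.prems have eq: "2 * string_code \<sigma> + of_bool b = 2 * string_code \<rho> + of_bool c" by simp
    then have "b = c" "string_code \<sigma> = string_code \<rho>"
      by (cases b; cases c; simp; arith)+
    then show ?thesis using Cons.IH Cons by simp
  qed
qed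

lemma bij_basic_code: "bij basic_code"
proof (rule bijI)
  show "inj basic_code"
  proof (rule injI)
    fix x y assume "basic_code x = basic_code y"
    then show "x = y"
      by (cases x; cases y) (simp_all add: string_code_inj)
  qed
  have "\<exists>d. n = basic_code d" for n
    using string_code_surj[of n] basic_code.simps by (metis gr0I)
  then show "surj basic_code" by (auto simp: surj_def)
qed

definition computable_basic_open :: "(nat \<Rightarrow> nat \<Rightarrow> (nat \<Rightarrow> bool) set) \<Rightarrow> bool" where
  "computable_basic_open B \<longleftrightarrow> (\<exists>D. recursive2 (\<lambda>i j. basic_code (D i j)) \<and>
     (\<forall>i j. B i j = basic_open (D i j)))"

definition Pi02 :: "(nat \<Rightarrow> bool) set \<Rightarrow> bool" where
  "Pi02 A \<longleftrightarrow> (\<exists>B. computable_basic_open B \<and> A = (\<Inter>i. \<Union>j. B i j))"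

end

theory Submission
  imports Defs
begin

text \<open>
  Write \<open>A = (\<Inter>i. \<Union>j. B i j)\<close>. For fixed \<open>n\<close> the sets \<open>\<Inter>i\<le>n. \<Union>j\<le>m. B i j\<close> are finite unions of
  cylinders which increase with \<open>m\<close> to a superset of \<open>A\<close>, so some \<open>m\<close> depending on \<open>n\<close> gives measure
  above \<open>\<delta>\<close>. A point outside \<open>A\<close> misses \<open>\<Union>j. B i j\<close> for some \<open>i\<close>, hence misses the chosen set for
  every \<open>n \<ge> i\<close>.
\<close>

text \<open>These are the clopen subsets of Cantor space; the empty family \<open>S\<close> yields
  the empty set.\<close>

definition finite_cyl_union :: "(nat \<Rightarrow> bool) set \<Rightarrow> bool" where
  "finite_cyl_union U \<longleftrightarrow> (\<exists>S. finite S \<and> U = (\<Union>\<sigma>\<in>S. cyl \<sigma>))"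

lemma finite_cyl_union_empty: "finite_cyl_union {}"
  unfolding finite_cyl_union_def by (rule exI[of _ "{}"]) simp

lemma finite_cyl_union_cyl: "finite_cyl_union (cyl \<sigma>)"
  unfolding finite_cyl_union_def by (rule exI[of _ "{\<sigma>}"]) simp

lemma finite_cyl_union_UNIV: "finite_cyl_union UNIV"
  using finite_cyl_union_cyl[of "[]"] by (simp add: cyl_def)

lemma finite_cyl_union_basic_open: "finite_cyl_union (basic_open d)"
  by (cases d) (simp_all add: finite_cyl_union_empty finite_cyl_union_cyl)

lemma finite_cyl_union_Un:
  assumes "finite_cyl_union U" "finite_cyl_union V"
  shows "finite_cyl_union (U \<union> V)"
proof -
  from assms obtain S T where "finite S" "U = (\<Union>\<sigma>\<in>S. cyl \<sigma>)" "finite T" "V = (\<Union>\<sigma>\<in>T. cyl \<sigma>)"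
    unfolding finite_cyl_union_def by blast
  then show ?thesis
    unfolding finite_cyl_union_def by (intro exI[of _ "S \<union> T"]) auto
qed

lemma finite_cyl_union_UN:
  assumes "finite I" "\<And>i. i \<in> I \<Longrightarrow> finite_cyl_union (U i)"
  shows "finite_cyl_union (\<Union>i\<in>I. U i)"
  using assms by (induction I) (simp_all add: finite_cyl_union_empty finite_cyl_union_Un)

text \<open>Either the shorter string is a prefix of the longer one, so the cylinders are nested, or
  the strings disagree at a common position and the cylinders are disjoint.\<close>

lemma cyl_Int_cyl:
  assumes "length \<sigma> \<le> length \<tau>"
  shows "cyl \<sigma> \<inter> cyl \<tau> = (if take (length \<sigma>) \<tau> = \<sigma> then cyl \<tau> else {})"
proof (cases "take (length \<sigma>) \<tau> = \<sigma>")
  case True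
  have "\<sigma> ! k = \<tau> ! k" if "k < length \<sigma>" for k
    using that by (metis True nth_take)
  then have "cyl \<tau> \<subseteq> cyl \<sigma>"
    using assms by (auto simp: cyl_def)
  then show ?thesis using True by auto
next
  case False
  \<comment> \<open>A point of both cylinders would need two different values at this
    \<open>k\<close>.\<close>
  then obtain k where "k < length \<sigma>" "\<tau> ! k \<noteq> \<sigma> ! k"
    using assms nth_equalityI[of "take (length \<sigma>) \<tau>" \<sigma>] by auto
  then show ?thesis using False assms by (auto simp: cyl_def)
qed

lemma finite_cyl_union_cyl_Int_cyl: "finite_cyl_union (cyl \<sigma> \<inter> cyl \<tau>)"
proof (cases "length \<sigma> \<le> length \<tau>")
  case True
  then show ?thesis by (simp add: cyl_Int_cyl finite_cyl_union_empty finite_cyl_union_cyl)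
next
  case False
  then have "cyl \<sigma> \<inter> cyl \<tau> = (if take (length \<tau>) \<sigma> = \<tau> then cyl \<sigma> else {})"
    using cyl_Int_cyl[of \<tau> \<sigma>] by (simp add: Int_commute)
  then show ?thesis by (simp add: finite_cyl_union_empty finite_cyl_union_cyl)
qed

lemma finite_cyl_union_Int:
  assumes "finite_cyl_union U" "finite_cyl_union V"
  shows "finite_cyl_union (U \<inter> V)"
proof -
  from assms obtain S T where ST: "finite S" "U = (\<Union>\<sigma>\<in>S. cyl \<sigma>)" "finite T" "V = (\<Union>\<tau>\<in>T. cyl \<tau>)"
    unfolding finite_cyl_union_def by blast
  \<comment> \<open>Distributivity reduces the claim to intersections of two cylinders.\<close>
  then have "U \<inter> V = (\<Union>\<sigma>\<in>S. \<Union>\<tau>\<in>T. cyl \<sigma> \<inter> cyl \<tau>)" by blast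
  moreover have "finite_cyl_union (\<Union>\<sigma>\<in>S. \<Union>\<tau>\<in>T. cyl \<sigma> \<inter> cyl \<tau>)"
    using ST by (intro finite_cyl_union_UN finite_cyl_union_cyl_Int_cyl)
  ultimately show ?thesis by simp
qed

lemma finite_cyl_union_INT:
  assumes "finite I" "\<And>i. i \<in> I \<Longrightarrow> finite_cyl_union (U i)"
  shows "finite_cyl_union (\<Inter>i\<in>I. U i)"
  using assms by (induction I) (simp_all add: finite_cyl_union_UNIV finite_cyl_union_Int)

lemma prob_space_cantor_measure: "prob_space cantor_measure"
  unfolding cantor_measure_def by (intro prob_space_PiM prob_space_uniform_bool)

lemma sets_cyl: "cyl \<sigma> \<in> sets cantor_measure"
  unfolding cantor_measure_def cyl_eq_prod_emb
  by (rule sets_PiM_I) (auto simp: sets_uniform_count_measure)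

lemma sets_finite_cyl_union: "finite_cyl_union U \<Longrightarrow> U \<in> sets cantor_measure"
  unfolding finite_cyl_union_def by (auto intro!: sets.finite_UN sets_cyl)

text \<open>Continuity from below. Finiteness of \<open>I\<close> allows one bound \<open>m\<close>
  to serve all inner unions at once.\<close>

lemma (in prob_space) exists_prob_INT_UN_gt:
  fixes B :: "'i \<Rightarrow> nat \<Rightarrow> 'a set"
  assumes "finite I" and sets: "\<And>i j. B i j \<in> events" and "I \<noteq> {}"
    and "A \<subseteq> (\<Inter>i\<in>I. \<Union>j. B i j)" "\<delta> < prob A"
  shows "\<exists>m. \<delta> < prob (\<Inter>i\<in>I. \<Union>j\<le>m. B i j)"
proof -
  define C where "C m = (\<Inter>i\<in>I. \<Union>j\<le>m. B i j)" for m
  \<comment> \<open>Here \<open>I \<noteq> {}\<close> matters: an empty intersection would be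
    \<open>UNIV\<close>, which need not be an event.\<close>
  have C_sets: "range C \<subseteq> events"
    using assms by (auto simp: C_def intro!: sets.finite_INT)
  have "incseq C"
    unfolding incseq_def C_def by (intro allI impI INF_mono' UN_mono) auto
  have "(\<Inter>i\<in>I. \<Union>j. B i j) \<subseteq> (\<Union>m. C m)"
  proof
    fix x assume "x \<in> (\<Inter>i\<in>I. \<Union>j. B i j)"
    then have "\<forall>i\<in>I. \<exists>j. x \<in> B i j" by blast
    then obtain J where J: "\<And>i. i \<in> I \<Longrightarrow> x \<in> B i (J i)"
      by metis
    \<comment> \<open>The largest of the finitely many witnesses \<open>J i\<close> is a stage that
      already contains \<open>x\<close>.\<close>
    have "J i \<le> Max (J ` I)" if "i \<in> I" for i
      using that \<open>finite I\<close> by simp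
    with J have "x \<in> C (Max (J ` I))"
      unfolding C_def by blast
    then show "x \<in> (\<Union>m. C m)" by blast
  qed
  then have "prob A \<le> prob (\<Union>m. C m)"
    using assms C_sets by (intro finite_measure_mono sets.countable_UN) auto
  then have "\<delta> < prob (\<Union>m. C m)" using assms by simp
  moreover have "(\<lambda>m. prob (C m)) \<longlonglongrightarrow> prob (\<Union>m. C m)"
    using C_sets \<open>incseq C\<close> by (rule finite_Lim_measure_incseq)
  \<comment> \<open>The limit lies strictly above \<open>\<delta>\<close>, so late terms do
    too.\<close>
  ultimately have "eventually (\<lambda>m. \<delta> < prob (C m)) sequentially"
    by (simp add: order_tendsto_iff)
  then show ?thesis
    unfolding C_def eventually_sequentially by blast
qed

theorem theorem2p4:
  fixes A :: "(nat \<Rightarrow> bool) set" and \<delta> :: real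
  assumes "Pi02 A" and "\<delta> > 0" and "measure cantor_measure A > \<delta>"
  shows "\<exists>f :: nat \<Rightarrow> (nat \<Rightarrow> bool) \<Rightarrow> real.
    (\<forall>i. \<exists>S :: bool list set. finite S \<and> f i = indicator (\<Union>\<sigma>\<in>S. cyl \<sigma>)) \<and>
    (\<forall>i. (LINT x|cantor_measure. f i x) > \<delta>) \<and>
    (\<forall>x. x \<notin> A \<longrightarrow> (\<lambda>i. f i x) \<longlonglongrightarrow> 0)"
proof -
  interpret prob_space cantor_measure by (rule prob_space_cantor_measure)
  from \<open>Pi02 A\<close> obtain B and D :: "nat \<Rightarrow> nat \<Rightarrow> bool list option"
    where "\<And>i j. B i j = basic_open (D i j)"
    and A: "A = (\<Inter>i. \<Union>j. B i j)"
    unfolding Pi02_def computable_basic_open_def by blast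
  then have B: "finite_cyl_union (B i j)" for i j
    by (simp add: finite_cyl_union_basic_open)
  have "\<exists>m. \<delta> < prob (\<Inter>i\<in>{..n}. \<Union>j\<le>m. B i j)" for n
    by (rule exists_prob_INT_UN_gt[where A = A])
       (use A assms in \<open>auto simp: sets_finite_cyl_union B\<close>)
  then obtain m where m: "\<And>n. \<delta> < prob (\<Inter>i\<in>{..n}. \<Union>j\<le>m n. B i j)"
    by metis
  define U where "U n = (\<Inter>i\<in>{..n}. \<Union>j\<le>m n. B i j)" for n
  have U: "finite_cyl_union (U n)" for n
    unfolding U_def by (intro finite_cyl_union_INT finite_cyl_union_UN B) auto
  show ?thesis
  proof (intro exI[of _ "\<lambda>n. indicator (U n)"] conjI allI impI)
    fix n
    show "\<exists>S. finite S \<and> indicat_real (U n) = indicator (\<Union>\<sigma>\<in>S. cyl \<sigma>)"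
      using U[of n] unfolding finite_cyl_union_def by auto
    \<comment> \<open>The integral of the indicator is the measure of \<open>U n\<close>, which
      exceeds \<open>\<delta>\<close> by the choice of \<open>m n\<close>.\<close>
    show "\<delta> < (LINT x|cantor_measure. indicator (U n) x)"
      using m[of n] sets_finite_cyl_union[OF U] by (simp add: U_def[symmetric])
  next
    fix x assume "x \<notin> A"
    then obtain i where "\<And>j. x \<notin> B i j" using A by blast
    then have "x \<notin> U n" if "n \<ge> i" for n
      using that by (auto simp: U_def)
    \<comment> \<open>From \<open>n = i\<close> on, the \<open>i\<close>-th union is among those
      intersected, so the values at \<open>x\<close> are constantly zero.\<close>
    then have "eventually (\<lambda>n. indicat_real (U n) x = 0) sequentially"
      unfolding eventually_sequentially by (intro exI[of _ i]) simp
    then show "(\<lambda>n. indicat_real (U n) x) \<longlonglongrightarrow> 0"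
      by (rule tendsto_eventually)
  qed
qed

end
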